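(* For $a\ge 2$ let $K_{a,a}$ denote the useful orientation of the complete bipartite graph with both parts of size $a$, and let $c=a(a-2)+1$. Then $T_c(K_{a,a})=\Omega(a!)$ as $a\to\infty$; that is, there exist a constant $\kappa>0$ and an integer $N$ such that for all $a\ge N$, with $c=a(a-2)+1$, one has $T_c(K_{a,a})\ge\kappa\, a!$.
   Context: A directed graph $D=(V,E)$ is a finite set of vertices $V$ with a set $E$ of ordered pairs of vertices; $(u,v)\in E$ is an edge directed from $u$ to $v$, and the out-degree $\deg^+ v$ is the number of edges directed from $v$. A parallel chip-firing game on $D$ starts with a finite nonnegative integer number of chips on each vertex. In each round, simultaneously, every vertex $v$ having at least $\deg^+ v$ chips fires, sending one chip along each of its outgoing edges; all other vertices wait. The game has period $T$ if $T$ is the smallest positive integer for which there is a round $t_0$ such that every vertex has the same number of chips in round $t$ as in round $t+T$ for all $t\ge t_0$. For a nonnegative integer $c$, the $c$-convergent period $T_c(D)$ is the minimum of the period $T$ over all parallel chip-firing games on $D$ with at least $c$ chips in total. The useful orientation of the complete bipartite graph with vertices $v_1,\dots,v_{2a}$, where the odd-indexed vertices form one part $L$ and the even-indexed vertices form the other part $R$, has exactly the following edges: (i) from $v_i$ to $v_{i+1}$ for each $1\le i<2a$, and from $v_{2a}$ to $v_1$; (ii) from $v_1$ to $v_{2i}$ for all $1\le i<a$; (iii) from $v_{2j+1}$ to all vertices $v_{2k}$ with $1\le k<j$ (for every $j$ with $1\le j\le a-1$); (iv) from $v_{2j}$ to all vertices $v_{2k-1}$ with $1<k<j$ (for every $j$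 with $1\le j\le a$). *)

theory Defs
  imports Complex_Main "Graph_Theory.Pair_Digraph"
begin

section \<open>Parallel chip-firing on a finite directed graph\<close>

text \<open>
  A digraph is a \<^typ>\<open>'a pair_pre_digraph\<close> (a vertex set and a set of ordered pairs); the
  finiteness and incidence conditions are those of the locale \<^locale>\<open>pair_fin_digraph\<close>.
  A position is a function giving the number of chips on each vertex; its values
  outside the vertex set play no role.
\<close>

definition fires :: "'a pair_pre_digraph \<Rightarrow> ('a \<Rightarrow> nat) \<Rightarrow> 'a \<Rightarrow> bool" where
  "fires D s v \<longleftrightarrow> v \<in> pverts D \<and> out_degree (with_proj D) v \<le> s v"

text \<open>The natural-number subtraction below never truncates, by the firing condition.\<close>

definition fire_round :: "'a pair_pre_digraph \<Rightarrow> ('a \<Rightarrow> nat) \<Rightarrow> ('a \<Rightarrow> nat)" where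
  "fire_round D s = (\<lambda>v.
     (if fires D s v then s v - out_degree (with_proj D) v else s v)
       + card {e \<in> parcs D. snd e = v \<and> fires D s (fst e)})"

definition chips_at :: "'a pair_pre_digraph \<Rightarrow> ('a \<Rightarrow> nat) \<Rightarrow> nat \<Rightarrow> ('a \<Rightarrow> nat)" where
  "chips_at D s t = (fire_round D ^^ t) s"

definition total_chips :: "'a pair_pre_digraph \<Rightarrow> ('a \<Rightarrow> nat) \<Rightarrow> nat" where
  "total_chips D s = (\<Sum>v\<in>pverts D. s v)"

definition eventually_repeats :: "'a pair_pre_digraph \<Rightarrow> ('a \<Rightarrow> nat) \<Rightarrow> nat \<Rightarrow> bool" where
  "eventually_repeats D s T \<longleftrightarrow>
     (\<exists>t0. \<forall>t\<ge>t0. \<forall>v\<in>pverts D. chips_at D s t v = chips_at D s (t + T) v)"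

definition has_period :: "'a pair_pre_digraph \<Rightarrow> ('a \<Rightarrow> nat) \<Rightarrow> nat \<Rightarrow> bool" where
  "has_period D s T \<longleftrightarrow>
     0 < T \<and> eventually_repeats D s T \<and> (\<forall>T'. 0 < T' \<and> eventually_repeats D s T' \<longrightarrow> T \<le> T')"

text \<open>
  The infimum of a nonempty set of natural numbers is its minimum.
  The set is nonempty for every finite digraph with at least one vertex,
  since the number of chips is conserved and so every game is eventually periodic.
\<close>

definition convergent_period :: "nat \<Rightarrow> 'a pair_pre_digraph \<Rightarrow> nat" where
  "convergent_period c D = Inf {T. \<exists>s. c \<le> total_chips D s \<and> has_period D s T}"

section \<open>The useful orientation of the complete bipartite graph\<close>

text \<open>
  The vertex \<open>v\<^sub>i\<close> is the number \<open>i\<close>, for \<open>1 \<le> i \<le> 2a\<close>.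
\<close>

definition useful_orientation :: "nat \<Rightarrow> nat pair_pre_digraph" where
  "useful_orientation a = \<lparr> pverts = {1..2 * a}, parcs =
       {(i, i + 1) | i. 1 \<le> i \<and> i < 2 * a} \<union> {(2 * a, 1)}
     \<union> {(1, 2 * i) | i. 1 \<le> i \<and> i < a}
     \<union> {(2 * j + 1, 2 * k) | j k. 1 \<le> j \<and> j \<le> a - 1 \<and> 1 \<le> k \<and> k < j}
     \<union> {(2 * j, 2 * k - 1) | j k. 1 \<le> j \<and> j \<le> a \<and> 1 < k \<and> k < j} \<rparr>"

lemma pair_fin_digraph_useful_orientation:
  assumes "a \<ge> 2"
  shows "pair_fin_digraph (useful_orientation a)"
proof -
  have sub: "parcs (useful_orientation a) \<subseteq> {1..2 * a} \<times> {1..2 * a}"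
    using assms by (auto simp: useful_orientation_def)
  have fin: "finite (parcs (useful_orientation a))"
    by (rule finite_subset[OF sub]) simp
  show ?thesis
  proof
    fix e assume "e \<in> parcs (useful_orientation a)"
    with sub have "e \<in> {1..2 * a} \<times> {1..2 * a}" by blast
    then show "fst e \<in> pverts (useful_orientation a)" "snd e \<in> pverts (useful_orientation a)"
      by (auto simp: useful_orientation_def)
  qed (use fin in \<open>auto simp: useful_orientation_def\<close>)
qed

lemma useful_orientation_bipartite:
  assumes "(u, w) \<in> parcs (useful_orientation a)"
  shows "odd u \<longleftrightarrow> even w"
  using assms by (auto simp: useful_orientation_def)

lemma useful_orientation_complete:
  assumes "a \<ge> 2" "u \<in> {1..2 * a}" "w \<in> {1..2 * a}" "odd u" "even w"
  shows "(u, w) \<in> parcs (useful_orientation a) \<longleftrightarrow> (w, u) \<notin> parcs (useful_orientation a)"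
proof -
  obtain m where u: "u = 2 * m + 1" using assms by (auto elim: oddE)
  obtain k where w: "w = 2 * k" using assms by (auto elim: evenE)
  have m: "m < a" and k: "1 \<le> k" "k \<le> a" using assms u w by auto
  have "(u, w) \<in> parcs (useful_orientation a) \<longleftrightarrow> k = m + 1 \<or> (m = 0 \<and> k < a) \<or> (1 \<le> m \<and> k < m)"
    using m k assms(1) unfolding u w useful_orientation_def
    apply simp
    by presburger
  moreover have "(w, u) \<in> parcs (useful_orientation a) \<longleftrightarrow>
      (k = m \<or> (k = a \<and> m = 0) \<or> (\<exists>i. 1 < i \<and> i < k \<and> 2 * m + 1 = 2 * i - 1))"
    using m k assms(1) unfolding u w useful_orientation_def
    apply simp
    by presburger
  moreover have "(\<exists>i. 1 < i \<and> i < k \<and> 2 * m + 1 = 2 * i - 1) \<longleftrightarrow> 1 \<le> m \<and> m + 1 < k"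
    by presburger
  ultimately show ?thesis
    using m k assms(1) by presburger
qed

end

theory Submission
  imports Defs
begin

text \<open>
  In one period every vertex loses as many chips as it gains, so the numbers \<open>x v\<close> of firings
  satisfy \<open>deg\<^sup>+ v * x v = (\<Sum>(u, v) \<in> E. x u)\<close>, while \<open>x v \<le> T\<close> since a vertex fires at most
  once per round. More than \<open>card E - card V\<close> chips force some vertex to fire in each round, and along
  the Hamiltonian cycle this propagates to all vertices, so \<open>x 1 \<ge> 1\<close>. Solving the balance equations of
  the useful orientation downwards from \<open>x (2 * a) = (a - 1) * x 1\<close>, the leading term dominates
  at each step, so that \<open>x (2 * m) \<ge> (m + 1) * x (2 * (m + 1))\<close> for \<open>m \<ge> 3\<close>; hence
  \<open>T \<ge> x 6 \<ge> a! / 3!\<close>.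
\<close>

section \<open>Conservation of chips and eventual periodicity\<close>

lemma out_degree_with_proj:
  "out_degree (with_proj D) v = card {e \<in> parcs D. fst e = v}"
  by (simp add: out_degree_def out_arcs_def)

lemma fire_round_balance:
  "fire_round D s v + (if fires D s v then out_degree (with_proj D) v else 0)
     = s v + card {e \<in> parcs D. snd e = v \<and> fires D s (fst e)}"
  by (simp add: fire_round_def fires_def)

lemma chips_at_0 [simp]: "chips_at D s 0 = s"
  by (simp add: chips_at_def)

lemma chips_at_Suc: "chips_at D s (Suc t) = fire_round D (chips_at D s t)"
  by (simp add: chips_at_def)

context pair_fin_digraph
begin

text \<open>Double counting: the arcs with a firing tail, grouped by tail, count the chips sent, and
  grouped by head, the chips received.\<close>

lemma total_chips_fire_round: "total_chips G (fire_round G s) = total_chips G s"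
proof -
  let ?F = "{e \<in> parcs G. fires G s (fst e)}"
  have fin: "finite ?F" by simp
  have "(\<Sum>v\<in>pverts G. if fires G s v then out_degree (with_proj G) v else 0)
      = (\<Sum>v\<in>pverts G. sum (\<lambda>_. 1) {e \<in> ?F. fst e = v})"
    by (rule sum.cong) (auto simp: out_degree_with_proj intro!: arg_cong[where f = card])
  also have "\<dots> = sum (\<lambda>_. 1) ?F"
    by (rule sum.group[OF fin]) (auto dest: in_arcsD1)
  also have "\<dots> = (\<Sum>v\<in>pverts G. sum (\<lambda>_. 1) {e \<in> ?F. snd e = v})"
    by (rule sum.group[OF fin, symmetric]) (auto dest: in_arcsD2)
  also have "\<dots> = (\<Sum>v\<in>pverts G. card {e \<in> parcs G. snd e = v \<and> fires G s (fst e)})"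
    by (rule sum.cong) (auto intro!: arg_cong[where f = card])
  finally have "(\<Sum>v\<in>pverts G. if fires G s v then out_degree (with_proj G) v else 0)
      = (\<Sum>v\<in>pverts G. card {e \<in> parcs G. snd e = v \<and> fires G s (fst e)})" .
  moreover have "(\<Sum>v\<in>pverts G. fire_round G s v
        + (if fires G s v then out_degree (with_proj G) v else 0))
      = (\<Sum>v\<in>pverts G. s v + card {e \<in> parcs G. snd e = v \<and> fires G s (fst e)})"
    by (simp only: fire_round_balance)
  ultimately show ?thesis
    by (simp add: total_chips_def sum.distrib)
qed

lemma total_chips_chips_at: "total_chips G (chips_at G s t) = total_chips G s"
  by (induction t) (simp_all add: chips_at_Suc total_chips_fire_round)

lemma fire_round_cong:
  assumes "\<forall>v\<in>pverts G. s v = s' v" "v \<in> pverts G"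
  shows "fire_round G s v = fire_round G s' v"
proof -
  have "fires G s = fires G s'"
    using assms(1) by (auto simp: fires_def fun_eq_iff)
  then show ?thesis
    using assms by (simp add: fire_round_def)
qed

text \<open>Pigeonhole: conservation bounds every vertex by the total, so only finitely many
  positions occur on \<open>pverts G\<close>. This later shows that the infimum in
  \<open>convergent_period\<close> is attained.\<close>

lemma ex_has_period: "\<exists>T. has_period G s T"
proof -
  \<comment> \<open>Restriction discards the unconstrained values outside \<open>pverts G\<close>,
    which makes the range finite.\<close>
  define r where "r t = restrict (chips_at G s t) (pverts G)" for t
  have "chips_at G s t v \<le> total_chips G s" if "v \<in> pverts G" for t v
    using member_le_sum[of v "pverts G" "chips_at G s t"] that
      total_chips_chips_at[of s t] by (simp add: total_chips_def)
  then have "range r \<subseteq> (\<Pi>\<^sub>E v\<in>pverts G. {..total_chips G s})"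
    by (auto simp: r_def)
  then have "finite (range r)"
    by (rule finite_subset) (auto intro: finite_PiE)
  then have "\<not> inj r"
    using finite_imageD by auto
  then obtain i j where "i < j" and ij: "r i = r j"
    by (metis injI linorder_neqE_nat)
  have shift: "\<forall>v\<in>pverts G. chips_at G s (i + n) v = chips_at G s (j + n) v" for n
  proof (induction n)
    case 0
    show ?case
      using ij unfolding r_def by (metis add_0_right restrict_apply')
  next
    case (Suc n)
    then show ?case
      by (auto simp: chips_at_Suc intro: fire_round_cong)
  qed
  have "chips_at G s t v = chips_at G s (t + (j - i)) v"
    if "i \<le> t" "v \<in> pverts G" for t v
    using that \<open>i < j\<close> shift[of "t - i"] by (simp add: add.commute)
  then have "0 < j - i \<and> eventually_repeats G s (j - i)"
    using \<open>i < j\<close> by (auto simp: eventually_repeats_def)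
  from LeastI[of "\<lambda>T. 0 < T \<and> eventually_repeats G s T", OF this] show ?thesis
    unfolding has_period_def
    by (intro exI[of _ "LEAST T. 0 < T \<and> eventually_repeats G s T"]) (auto intro: Least_le)
qed

text \<open>If every vertex waits, each holds at most its out-degree minus one; summing bounds the
  total by the number of arcs minus the number of vertices.\<close>

lemma ex_fires:
  assumes "card (parcs G) < total_chips G s + card (pverts G)"
  shows "\<exists>v\<in>pverts G. fires G s v"
proof (rule ccontr)
  assume "\<not> ?thesis"
  then have "s v + 1 \<le> card {e \<in> parcs G. fst e = v}" if "v \<in> pverts G" for v
    using that by (auto simp: fires_def out_degree_with_proj)
  then have "(\<Sum>v\<in>pverts G. s v + 1) \<le> (\<Sum>v\<in>pverts G. sum (\<lambda>_. 1) {e \<in> parcs G. fst e = v})"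
    by (intro sum_mono) simp
  also have "\<dots> = sum (\<lambda>_. 1) (parcs G)"
    by (rule sum.group) (auto dest: in_arcsD1)
  finally show False
    using assms by (simp add: total_chips_def sum_Suc)
qed

end

section \<open>Firing counts\<close>

definition firing_count :: "'a pair_pre_digraph \<Rightarrow> ('a \<Rightarrow> nat) \<Rightarrow> nat \<Rightarrow> nat \<Rightarrow> 'a \<Rightarrow> nat" where
  "firing_count D s t n v = (\<Sum>i<n. of_bool (fires D (chips_at D s (t + i)) v))"

lemma firing_count_le: "firing_count D s t n v \<le> n"
  unfolding firing_count_def
  by (rule order_trans[OF sum_bounded_above[where K = 1]]) auto

context pair_fin_digraph
begin

text \<open>This is \<open>fire_round_balance\<close> summed over \<open>n\<close> rounds; losses
  stand on the left so that no natural-number subtraction occurs.\<close>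

lemma chips_at_balance:
  "chips_at G s (t + n) v + out_degree (with_proj G) v * firing_count G s t n v
     = chips_at G s t v + (\<Sum>e\<in>{e \<in> parcs G. snd e = v}. firing_count G s t n (fst e))"
proof (induction n)
  case 0
  show ?case by (simp add: firing_count_def)
next
  case (Suc n)
  let ?s = "chips_at G s (t + n)"
  have "card {e \<in> parcs G. snd e = v \<and> fires G ?s (fst e)}
      = (\<Sum>e\<in>{e \<in> parcs G. snd e = v}. of_bool (fires G ?s (fst e)))"
    by (simp add: sum.If_cases of_bool_def Collect_conj_eq[symmetric] Int_def conj_assoc)
  with Suc fire_round_balance[of G ?s v] show ?case
    by (simp add: chips_at_Suc firing_count_def sum.distrib distrib_left split: if_splits)
qed

lemma firing_count_balance:
  assumes "chips_at G s (t + n) v = chips_at G s t v"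
  shows "card {w. (v, w) \<in> parcs G} * firing_count G s t n v
     = (\<Sum>u | (u, v) \<in> parcs G. firing_count G s t n u)"
proof -
  have "{e \<in> parcs G. fst e = v} = Pair v ` {w. (v, w) \<in> parcs G}"
    by auto
  then have "out_degree (with_proj G) v = card {w. (v, w) \<in> parcs G}"
    by (simp add: out_degree_with_proj card_image inj_on_def)
  moreover have "{e \<in> parcs G. snd e = v} = (\<lambda>u. (u, v)) ` {u. (u, v) \<in> parcs G}"
    by auto
  then have "(\<Sum>e\<in>{e \<in> parcs G. snd e = v}. firing_count G s t n (fst e))
      = (\<Sum>u | (u, v) \<in> parcs G. firing_count G s t n u)"
    by (simp add: sum.reindex inj_on_def)
  ultimately show ?thesis
    using chips_at_balance[of s t n v] assms by simp
qed

text \<open>The balance at \<open>v\<close> makes a sum of naturals over its in-neighbours vanish,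
  so silence spreads backwards along arcs.\<close>

lemma firing_count_eq_0:
  assumes "chips_at G s (t + n) v = chips_at G s t v"
    and "(u, v) \<in> parcs G" "firing_count G s t n v = 0"
  shows "firing_count G s t n u = 0"
proof -
  have "finite {u. (u, v) \<in> parcs G}"
    by (rule finite_subset[of _ "fst ` parcs G"]) force+
  then show ?thesis
    using firing_count_balance[OF assms(1)] assms(2,3) by simp
qed

end

section \<open>The useful orientation\<close>

text \<open>Each odd-even pair carries exactly one arc, so putting the odd endpoint first is a
  bijection from the arcs onto the product of the two parts.\<close>

lemma card_parcs_useful_orientation:
  assumes "a \<ge> 2"
  shows "card (parcs (useful_orientation a)) = a * a"
proof -
  let ?E = "parcs (useful_orientation a)"
  let ?L = "{u \<in> {1..2 * a}. odd u}" and ?R = "{u \<in> {1..2 * a}. even u}"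
  let ?f = "\<lambda>(u, w). if odd u then (u, w) else (w, u :: nat)"
  interpret pair_fin_digraph "useful_orientation a"
    using assms by (rule pair_fin_digraph_useful_orientation)
  have verts: "u \<in> {1..2 * a} \<and> w \<in> {1..2 * a}" if "(u, w) \<in> ?E" for u w
    using in_arcsD1[OF that] in_arcsD2[OF that] by (simp add: useful_orientation_def)
  note complete = useful_orientation_complete[OF assms]
  have "bij_betw ?f ?E (?L \<times> ?R)"
  proof (rule bij_betw_imageI)
    show "inj_on ?f ?E"
    proof (rule inj_onI)
      fix e e' assume *: "e \<in> ?E" "e' \<in> ?E" "?f e = ?f e'"
      obtain u w u' w' where e: "e = (u, w)" "e' = (u', w')"
        by (cases e, cases e')
      note E = *(1)[unfolded e] *(2)[unfolded e]
      show "e = e'"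
        using *(3) E verts[OF E(1)] verts[OF E(2)] complete[of u w] complete[of w u]
          useful_orientation_bipartite[OF E(1)] useful_orientation_bipartite[OF E(2)]
        by (auto simp: e split: if_splits)
    qed
    show "?f ` ?E = ?L \<times> ?R"
    proof
      show "?f ` ?E \<subseteq> ?L \<times> ?R"
        using verts useful_orientation_bipartite by (fastforce split: if_splits)
      show "?L \<times> ?R \<subseteq> ?f ` ?E"
      proof clarify
        fix u w assume *: "u \<in> {1..2 * a}" "odd u" "w \<in> {1..2 * a}" "even w"
        then have "(u, w) \<in> ?E \<or> (w, u) \<in> ?E"
          using complete[of u w] by blast
        then show "(u, w) \<in> ?f ` ?E"
        proof
          assume "(u, w) \<in> ?E"
          then show ?thesis by (rule rev_image_eqI) (use * in simp)
        next
          assume "(w, u) \<in> ?E"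
          then show ?thesis by (rule rev_image_eqI) (use * in simp)
        qed
      qed
    qed
  qed
  then have "card ?E = card (?L \<times> ?R)"
    by (rule bij_betw_same_card)
  moreover have "?L = (\<lambda>i. 2 * i + 1) ` {..<a}"
  proof (intro equalityI subsetI)
    fix u assume "u \<in> ?L"
    then show "u \<in> (\<lambda>i. 2 * i + 1) ` {..<a}"
      by (intro image_eqI[of _ _ "u div 2"]) (auto, presburger+)
  qed auto
  moreover have "?R = (\<lambda>i. 2 * i) ` {1..a}"
  proof (intro equalityI subsetI)
    fix u assume "u \<in> ?R"
    then show "u \<in> (\<lambda>i. 2 * i) ` {1..a}"
      by (intro image_eqI[of _ _ "u div 2"]) auto
  qed auto
  ultimately show ?thesis
    by (simp add: card_cartesian_product card_image inj_on_def)
qed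

section \<open>Out-degrees and in-neighbourhoods of the useful orientation\<close>

lemma useful_orientation_out_odd:
  assumes "1 \<le> m" "m < a"
  shows "card {w. (2 * m + 1, w) \<in> parcs (useful_orientation a)} = m"
proof -
  have "{w. (2 * m + 1, w) \<in> parcs (useful_orientation a)} = insert (2 * m + 2) ((*) 2 ` {1..<m})"
    using assms by (auto simp: useful_orientation_def) presburger+
  then show ?thesis
    using assms by (simp add: card_image inj_on_def image_iff)
qed

lemma useful_orientation_in_odd:
  assumes "1 \<le> m" "m < a"
  shows "{u. (u, 2 * m + 1) \<in> parcs (useful_orientation a)} = insert (2 * m) ((*) 2 ` {m + 2..a})"
  using assms by (auto simp: useful_orientation_def image_iff) presburger+

lemma useful_orientation_out_even:
  assumes "2 \<le> k" "k \<le> a"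
  shows "card {w. (2 * k, w) \<in> parcs (useful_orientation a)} = k - 1"
proof -
  \<comment> \<open>The conditional covers the cycle arc, which at \<open>k = a\<close> wraps around
    to vertex 1.\<close>
  have "{w. (2 * k, w) \<in> parcs (useful_orientation a)}
      = insert (if k < a then 2 * k + 1 else 1) ((\<lambda>i. 2 * i - 1) ` {2..<k})"
    using assms by (auto simp: useful_orientation_def image_iff) presburger+
  moreover have "inj_on (\<lambda>i::nat. 2 * i - 1) {2..<k}"
    by (auto simp: inj_on_def)
  ultimately show ?thesis
    using assms by (auto simp: card_image card_insert_if image_iff)
qed

lemma useful_orientation_in_even:
  assumes "2 \<le> k" "k < a"
  shows "{u. (u, 2 * k) \<in> parcs (useful_orientation a)}
     = {1, 2 * k - 1} \<union> (\<lambda>j. 2 * j + 1) ` {k + 1..<a}"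
  using assms by (auto simp: useful_orientation_def image_iff) presburger+

lemma useful_orientation_in_last:
  assumes "2 \<le> a"
  shows "{u. (u, 2 * a) \<in> parcs (useful_orientation a)} = {2 * a - 1}"
  using assms by (auto simp: useful_orientation_def)

lemma useful_orientation_out_first:
  assumes "2 \<le> a"
  shows "card {w. (1, w) \<in> parcs (useful_orientation a)} = a - 1"
proof -
  \<comment> \<open>The cycle arc from 1 to 2 is also one of the arcs from 1 to the even vertices
    below \<open>2 * a\<close>, so it adds nothing to the count.\<close>
  have "{w. (1, w) \<in> parcs (useful_orientation a)} = (*) 2 ` {1..<a}"
    using assms by (auto simp: useful_orientation_def image_iff) (rule bexI[of _ 1], simp_all)
  then show ?thesis
    by (simp add: card_image inj_on_def)
qed

lemma useful_orientation_in_first: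
  assumes "2 \<le> a"
  shows "{u. (u, 1) \<in> parcs (useful_orientation a)} = {2 * a}"
  using assms by (auto simp: useful_orientation_def)

section \<open>Factorial growth forced by the balance equations\<close>

text \<open>The sequences \<open>p\<close> and \<open>q\<close> are the firing counts of the even and of the odd vertices.\<close>

lemma balance_growth:
  fixes p q :: "nat \<Rightarrow> nat"
  assumes a: "4 \<le> a"
    and first: "(a - 1) * q 0 = p a"
    and last: "(a - 1) * p a = q (a - 1)"
    and odds: "\<And>m. 1 \<le> m \<Longrightarrow> m < a \<Longrightarrow> m * q m = p m + (\<Sum>j=m + 2..a. p j)"
    and evens: "\<And>k. 2 \<le> k \<Longrightarrow> k < a \<Longrightarrow> (k - 1) * p k = q (k - 1) + q 0 + (\<Sum>j=k + 1..<a. q j)"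
  shows "fact a * q 0 \<le> fact 3 * p 3"
proof -
  define S where "S m = (\<Sum>j=m..a. p j)" for m
  define Q where "Q k = q 0 + (\<Sum>j=k..<a. q j)" for k
  \<comment> \<open>The three tail bounds let the leading terms dominate the balance equations at
    \<open>m\<close> and \<open>m - 1\<close>; the last clause accumulates the factorial as
    \<open>m\<close> decreases from \<open>a - 1\<close> to 3.\<close>
  define I where "I m \<longleftrightarrow> S (m + 1) \<le> 2 * q m \<and> S (m + 2) \<le> q m \<and> Q (m + 1) \<le> p m
      \<and> fact a * q 0 \<le> fact m * p m" for m
  have "3 \<le> a - 1" using a by simp
  then have "I 3"
  proof (induction rule: inc_induct)
    case base
    \<comment> \<open>At \<open>b = a - 1\<close> the three tails are just \<open>p a\<close>, 0 and
      \<open>q 0\<close>, and the equations give \<open>p b = b^3 * q 0\<close>.\<close>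
    obtain b where b: "a = b + 1" "3 \<le> b"
      using a by (metis \<open>3 \<le> a - 1\<close> add.commute le_add_diff_inverse le_trans one_le_numeral)
    have q: "q b = b * p a" and p: "p b = b * q b" and p0: "p a = b * q 0"
      using first last odds[of b] b by simp_all
    have le: "x \<le> b * x" "2 * x \<le> b * x" for x
      using b mult_le_mono1[of 2 b x] by auto
    have "(b + 1) * q 0 \<le> 2 * b * q 0"
      using b by (intro mult_le_mono1) simp
    also have "\<dots> \<le> q b"
      using le(2)[of "p a"] unfolding q p0 by (simp only: mult.assoc)
    also have "\<dots> \<le> p b"
      using le(1)[of "q b"] unfolding p .
    finally have "fact b * ((b + 1) * q 0) \<le> fact b * p b"
      by (rule mult_le_mono2)
    then have "fact a * q 0 \<le> fact b * p b"
      using b by (simp add: algebra_simps)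
    moreover have "p a \<le> q b" "q 0 \<le> p a" "q b \<le> p b"
      using le p q p0 by metis+
    ultimately show ?case
      using b by (simp add: I_def S_def Q_def)
  next
    case (step n)
    define m where "m = Suc n"
    have m: "m < a" "3 \<le> n" "n + 1 = m" using step by (auto simp: m_def)
    have IH: "S (m + 1) \<le> 2 * q m" "S (m + 2) \<le> q m" "Q (m + 1) \<le> p m"
      "fact a * q 0 \<le> fact m * p m"
      using step.IH by (auto simp: I_def m_def)
    have qn: "n * p m = q n + Q (m + 1)"
      using evens[of m] m by (auto simp: Q_def m_def)
    have pm: "m * q m = p m + S (m + 2)"
      using odds[of m] m by (auto simp: S_def)
    have pn: "n * q n = p n + S (m + 1)"
      using odds[of n] m by (auto simp: S_def m_def)
    have S: "S m = p m + S (m + 1)"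
      using m by (simp add: S_def sum.atLeast_Suc_atMost)
    have Q: "Q m = q m + Q (m + 1)"
      using m by (simp add: Q_def sum.atLeast_Suc_lessThan)
    have three: "3 * x \<le> n * x" "3 * x \<le> m * x" for x
      using m by (auto intro: mult_le_mono1)
    \<comment> \<open>In each equation the coefficient is at least 3 and the tail costs at most one
      copy of the leading term, leaving a factor of 2. For the third, \<open>S (m + 1)\<close> is at
      most \<open>2 * q m\<close>, hence at most \<open>p m\<close> and then
      \<open>q n\<close>.\<close>
    have 1: "2 * q m \<le> p m" using three(2)[of "q m"] pm IH by linarith
    have 2: "2 * p m \<le> q n" using three(1)[of "p m"] qn IH by linarith
    have 3: "2 * q n \<le> p n" using three(1)[of "q n"] pn IH 1 2 by linarith
    have "(n - 1) * q n \<le> p n"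
      using pn IH 1 2 by (simp add: diff_mult_distrib)
    then have "(n - 1) * (2 * p m) \<le> p n"
      using mult_le_mono2[OF 2, of "n - 1"] by linarith
    \<comment> \<open>This requires \<open>n\<close> to be at least 3, where the descent
      stops.\<close>
    moreover have "m \<le> (n - 1) * 2"
      using m by simp
    then have "m * p m \<le> (n - 1) * 2 * p m"
      by (rule mult_le_mono1)
    ultimately have "m * p m \<le> p n"
      by (metis mult.assoc le_trans)
    then have "fact n * (m * p m) \<le> fact n * p n"
      by (rule mult_le_mono2)
    then have "fact m * p m \<le> fact n * p n"
      by (simp add: m_def algebra_simps)
    with 1 2 3 IH S Q m show ?case
      by (auto simp: I_def)
  qed
  then show ?thesis by (simp add: I_def)
qed

section \<open>Lower bound on the period\<close>

theorem theorem3p15: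
  shows "\<exists>\<kappa>::real. \<kappa> > 0 \<and> (\<exists>N::nat. \<forall>a::nat. a \<ge> N \<and> a \<ge> 2 \<longrightarrow>
           real (convergent_period (a * (a - 2) + 1) (useful_orientation a)) \<ge> \<kappa> * fact a)"
proof -
  \<comment> \<open>The bound is uniform over all games with enough chips; 6 is
    \<open>fact 3\<close>, the price of stopping the descent at index 3.\<close>
  have period: "fact a \<le> 6 * T"
    if a: "4 \<le> a" and chips: "a * (a - 2) + 1 \<le> total_chips (useful_orientation a) s"
      and T: "has_period (useful_orientation a) s T" for a s T
  proof -
    let ?D = "useful_orientation a"
    let ?E = "parcs ?D"
    interpret pair_fin_digraph ?D
      using a by (intro pair_fin_digraph_useful_orientation) simp
    have verts: "pverts ?D = {1..2 * a}"
      by (simp add: useful_orientation_def)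
    have "0 < T" and "eventually_repeats ?D s T"
      using T by (simp_all add: has_period_def)
    then obtain t where "\<forall>v\<in>{1..2 * a}. chips_at ?D s t v = chips_at ?D s (t + T) v"
      unfolding eventually_repeats_def verts by blast
    then have t: "chips_at ?D s (t + T) v = chips_at ?D s t v" if "v \<in> {1..2 * a}" for v
      using that by simp
    define x where "x = firing_count ?D s t T"
    have bal: "card {w. (v, w) \<in> ?E} * x v = (\<Sum>u | (u, v) \<in> ?E. x u)"
      if "v \<in> {1..2 * a}" for v
      unfolding x_def by (rule firing_count_balance[OF t[OF that]])
    \<comment> \<open>With \<open>a * a\<close> arcs and \<open>2 * a\<close> vertices,
      \<open>a * (a - 2) + 1\<close> is exactly the least total that \<open>ex_fires\<close>
      accepts.\<close>
    have "a * (a - 2) + 2 * a = a * a"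
      using a by (simp add: diff_mult_distrib2)
    then have "\<exists>v\<in>{1..2 * a}. fires ?D (chips_at ?D s t) v"
      using ex_fires[of "chips_at ?D s t"] chips a
      by (simp add: verts total_chips_chips_at card_parcs_useful_orientation)
    then obtain v where v: "v \<in> {1..2 * a}" "fires ?D (chips_at ?D s t) v"
      by blast
    \<comment> \<open>The firing in round \<open>t\<close> is the term with offset 0 of the
      count.\<close>
    have "x v \<noteq> 0"
      using v(2) \<open>0 < T\<close> by (auto simp: x_def firing_count_def intro!: bexI[of _ 0])
    \<comment> \<open>A silent vertex 1 would silence \<open>2 * a\<close> through the closing arc
      of the cycle, and then every vertex down the path to \<open>v\<close>.\<close>
    have "0 < x 1"
    proof (rule ccontr)
      assume "\<not> 0 < x 1"
      then have "x 1 = 0" by simp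
      moreover have "(2 * a, 1) \<in> ?E"
        by (simp add: useful_orientation_def)
      ultimately have last: "x (2 * a) = 0"
        using firing_count_eq_0[OF t, of 1 "2 * a"] a by (simp add: x_def)
      have "v \<le> 2 * a" using v by simp
      then have "x v = 0"
      proof (induction rule: inc_induct)
        case base
        show ?case by (rule last)
      next
        case (step n)
        have "(n, Suc n) \<in> ?E"
          using step v by (simp add: useful_orientation_def)
        then show ?case
          using firing_count_eq_0[OF t, of "Suc n" n] step by (simp add: x_def)
      qed
      with \<open>x v \<noteq> 0\<close> show False by simp
    qed
    \<comment> \<open>The index \<open>2 * 0 + 1\<close> is vertex 1, written so as to match
      \<open>q 0\<close> in \<open>balance_growth\<close>.\<close>
    have growth: "fact a * x (2 * 0 + 1) \<le> fact 3 * x (2 * 3)"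
    proof (rule balance_growth[OF a, where p = "\<lambda>k. x (2 * k)" and q = "\<lambda>k. x (2 * k + 1)"])
      show "(a - 1) * x (2 * 0 + 1) = x (2 * a)"
        using bal[of 1] a useful_orientation_out_first[of a] useful_orientation_in_first[of a]
        by simp
      have "2 * (a - 1) + 1 = 2 * a - 1" using a by simp
      then show "(a - 1) * x (2 * a) = x (2 * (a - 1) + 1)"
        using bal[of "2 * a"] a useful_orientation_out_even[of a a] useful_orientation_in_last[of a]
        by simp
      show "m * x (2 * m + 1) = x (2 * m) + (\<Sum>j=m + 2..a. x (2 * j))" if "1 \<le> m" "m < a" for m
        using bal[of "2 * m + 1"] that useful_orientation_out_odd[OF that]
          useful_orientation_in_odd[OF that]
        by (simp add: sum.reindex inj_on_def image_iff)
      show "(k - 1) * x (2 * k)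
          = x (2 * (k - 1) + 1) + x (2 * 0 + 1) + (\<Sum>j=k + 1..<a. x (2 * j + 1))"
        if "2 \<le> k" "k < a" for k
      proof -
        have *: "2 * (k - 1) + 1 = 2 * k - 1" using that by simp
        have "(k - 1) * x (2 * k) = sum x ({1, 2 * k - 1} \<union> (\<lambda>j. 2 * j + 1) ` {k + 1..<a})"
          using bal[of "2 * k"] that useful_orientation_out_even[of k a]
            useful_orientation_in_even[OF that] by simp
        \<comment> \<open>The indices \<open>2 * j + 1\<close> with \<open>j > k\<close> exceed both
          1 and \<open>2 * k - 1\<close>.\<close>
        also have "\<dots> = sum x {1, 2 * k - 1} + sum x ((\<lambda>j. 2 * j + 1) ` {k + 1..<a})"
          using that by (intro sum.union_disjoint) auto
        also have "\<dots> = x 1 + x (2 * k - 1) + (\<Sum>j=k + 1..<a. x (2 * j + 1))"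
          using that by (simp add: sum.reindex inj_on_def)
        finally show ?thesis unfolding * by simp
      qed
    qed
    have "fact a \<le> fact a * x 1"
      using \<open>0 < x 1\<close> by simp
    also have "\<dots> \<le> 6 * x 6"
      using growth by (simp add: fact_numeral)
    also have "\<dots> \<le> 6 * T"
      unfolding x_def by (intro mult_le_mono2 firing_count_le)
    finally show ?thesis .
  qed
  have "1 / 6 * fact a \<le> real (convergent_period (a * (a - 2) + 1) (useful_orientation a))"
    if a: "4 \<le> a" for a
  proof -
    let ?P = "{T. \<exists>s. a * (a - 2) + 1 \<le> total_chips (useful_orientation a) s
      \<and> has_period (useful_orientation a) s T}"
    interpret pair_fin_digraph "useful_orientation a"
      using a by (intro pair_fin_digraph_useful_orientation) simp
    \<comment> \<open>Vertex 1 alone already holds enough chips, so this game qualifies.\<close>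
    define s :: "nat \<Rightarrow> nat" where "s = (\<lambda>_. a * (a - 2) + 1)"
    have "s 1 \<le> total_chips (useful_orientation a) s"
      unfolding total_chips_def
      by (rule member_le_sum) (use a in \<open>auto simp: useful_orientation_def\<close>)
    then have "a * (a - 2) + 1 \<le> total_chips (useful_orientation a) s"
      by (simp add: s_def)
    with ex_has_period[of s] have "?P \<noteq> {}"
      by blast
    then have "Inf ?P \<in> ?P"
      by (rule Inf_nat_def1)
    then have "fact a \<le> 6 * convergent_period (a * (a - 2) + 1) (useful_orientation a)"
      using period[OF a] unfolding convergent_period_def by blast
    then have "real (fact a) \<le> real (6 * convergent_period (a * (a - 2) + 1) (useful_orientation a))"
      by (rule of_nat_mono)
    then show ?thesis by simp
  qed
  then show ?thesis
    by (intro exI[of _ "1 / 6"] conjI exI[of _ 4]) auto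
qed

end
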